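(* Let $N=2^n$, $d=2^r$, $M=N/d$. Let $H$ be a Hermitian operator on $\mathbb{C}^N$ with eigenvalues $E_1\le E_2\le\cdots\le E_N$ (counted with multiplicity), and let $\{P_i\}_{i=1}^M$ be mutually orthogonal projectors of rank $d$ with $\sum_iP_i=\mathbb{I}_N$. Let $\rho$ be any density operator on $\mathbb{C}^N$, let $p_i=\mathrm{Tr}[\rho P_i]$ for $i\in[1,M]$ be the true measurement probabilities, labelled so that $p_1\ge p_2\ge\cdots\ge p_M$, and let $\{\widetilde p_i\}_{i=1}^M$ be real numbers (estimated probabilities). Let $\pi$ be a permutation of $\{1,\dots,M\}$ such that $\widetilde p_{\pi(i)}\ge\widetilde p_{\pi(i+1)}$ for all $i\in[1,M-1]$. Then $$\left|\widetilde{\mathrm{Erg}}_{\mathrm{obs}}(\rho)-\mathrm{Erg}_{\mathrm{obs}}(\rho)\right|=\left|\sum_{j=1}^M\big(p_j-p_{\pi(j)}\big)\overline{E}_j\right|\le\|H\|\sum_{j=1}^M\left|p_j-p_{\pi(j)}\right|,$$ where $\overline{E}_j=\frac1d\sum_{k=(j-1)d+1}^{jd}E_k$.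
   Context: Fix an orthonormal eigenbasis $|\phi_1\rangle,\dots,|\phi_N\rangle$ of $H$ with $H|\phi_k\rangle=E_k|\phi_k\rangle$, and split it into $M$ contiguous blocks $A_j=\{|\phi_{(j-1)d+1}\rangle,\dots,|\phi_{jd}\rangle\}$; $\overline{E}_j$ is the average energy of block $A_j$. The coarse-grained state is $\widetilde\rho=\sum_{i=1}^M p_iP_i/d$. Observational ergotropy: $\mathrm{Erg}_{\mathrm{obs}}(\rho)=\mathrm{Tr}[H(\rho-U_{\mathrm{gl}}\widetilde\rho U_{\mathrm{gl}}^\dagger)]$, where $U_{\mathrm{gl}}$ is a unitary mapping an orthonormal basis of the range of $P_i$ onto $A_i$ for each $i$ (recall $p_1\ge\cdots\ge p_M$). Guessed observational ergotropy: $\widetilde{\mathrm{Erg}}_{\mathrm{obs}}(\rho)=\mathrm{Tr}[H(\rho-\widetilde U_{\mathrm{gl}}\widetilde\rho\,\widetilde U_{\mathrm{gl}}^\dagger)]$, where $\widetilde U_{\mathrm{gl}}$ is a unitary mapping an orthonormal basis of the range of $P_{\pi(i)}$ onto $A_i$ for each $i$. $\|H\|$ is the spectral norm. *)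

theory Defs
  imports "HOL-Analysis.Analysis"
begin

text \<open>
  Operators on an $N$-dimensional complex Hilbert space are matrices of type
  \<^typ>\<open>complex^'n^'n\<close> with \<^prop>\<open>CARD('n) = N\<close>. The library's inner product on
  \<^typ>\<open>complex^'n\<close> is the real part of the Hermitian one, so the latter is defined here
  (antilinear in its first argument); the library norm on \<^typ>\<open>complex^'n\<close> is the Euclidean norm.
\<close>

definition cinner :: "complex^'n \<Rightarrow> complex^'n \<Rightarrow> complex" where
  "cinner u v = (\<Sum>i\<in>UNIV. cnj (u $ i) * v $ i)"

definition adj :: "complex^'n^'m \<Rightarrow> complex^'m^'n" where
  "adj A = (\<chi> i j. cnj (A $ j $ i))"

definition hermitian :: "complex^'n^'n \<Rightarrow> bool" where
  "hermitian A \<longleftrightarrow> adj A = A"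

definition unitary :: "complex^'n^'n \<Rightarrow> bool" where
  "unitary U \<longleftrightarrow> adj U ** U = mat 1 \<and> U ** adj U = mat 1"

definition projector :: "complex^'n^'n \<Rightarrow> bool" where
  "projector P \<longleftrightarrow> hermitian P \<and> P ** P = P"

definition density_operator :: "complex^'n^'n \<Rightarrow> bool" where
  "density_operator \<rho> \<longleftrightarrow>
     hermitian \<rho> \<and> (\<forall>v. 0 \<le> Re (cinner v (\<rho> *v v))) \<and> trace \<rho> = 1"

text \<open>The operator norm induced by the Euclidean norm.\<close>

definition spectral_norm :: "complex^'n^'n \<Rightarrow> real" where
  "spectral_norm A = onorm (\<lambda>v. A *v v)"

definition orthonormal_set :: "(complex^'n) set \<Rightarrow> bool" where
  "orthonormal_set B \<longleftrightarrow> (\<forall>u\<in>B. \<forall>v\<in>B. cinner u v = (if u = v then 1 else 0))"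

definition orthonormal_basis_of :: "(complex^'n) set \<Rightarrow> (complex^'n) set \<Rightarrow> bool" where
  "orthonormal_basis_of B V \<longleftrightarrow> orthonormal_set B \<and> vec.span B = V"

text \<open>
  \<open>\<phi> 1, \<dots>, \<phi> N\<close> is an orthonormal basis of the whole space consisting of eigenvectors of \<open>H\<close>, with
  eigenvalues \<open>E 1, \<dots>, E N\<close>; thus \<open>E\<close> lists the eigenvalues of \<open>H\<close> with multiplicity.
\<close>

definition orthonormal_eigenbasis ::
    "complex^'n^'n \<Rightarrow> (nat \<Rightarrow> real) \<Rightarrow> (nat \<Rightarrow> complex^'n) \<Rightarrow> nat \<Rightarrow> bool" where
  "orthonormal_eigenbasis H E \<phi> N \<longleftrightarrow>
     inj_on \<phi> {1..N} \<and> orthonormal_basis_of (\<phi> ` {1..N}) UNIV \<and>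
     (\<forall>k\<in>{1..N}. H *v \<phi> k = complex_of_real (E k) *s \<phi> k)"

definition block :: "(nat \<Rightarrow> complex^'n) \<Rightarrow> nat \<Rightarrow> nat \<Rightarrow> (complex^'n) set" where
  "block \<phi> d j = \<phi> ` {(j - 1) * d + 1..j * d}"

definition block_energy :: "(nat \<Rightarrow> real) \<Rightarrow> nat \<Rightarrow> nat \<Rightarrow> real" where
  "block_energy E d j = (\<Sum>k = (j - 1) * d + 1..j * d. E k) / real d"

text \<open>The trace below is real when \<open>\<rho>\<close> and \<open>P\<close> are Hermitian, see the lemma that follows.\<close>

definition meas_prob :: "complex^'n^'n \<Rightarrow> complex^'n^'n \<Rightarrow> real" where
  "meas_prob \<rho> P = Re (trace (\<rho> ** P))"

lemma of_real_meas_prob: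
  assumes "hermitian \<rho>" and "hermitian P"
  shows "complex_of_real (meas_prob \<rho> P) = trace (\<rho> ** P)"
proof -
  have \<rho>: "cnj (\<rho> $ i $ j) = \<rho> $ j $ i" and P: "cnj (P $ i $ j) = P $ j $ i" for i j
    using assms by (auto simp: hermitian_def adj_def vec_eq_iff)
  have "cnj (trace (\<rho> ** P)) = trace (P ** \<rho>)"
    by (simp add: trace_def matrix_matrix_mult_def \<rho> P mult.commute)
  also have "\<dots> = trace (\<rho> ** P)"
    by (rule trace_mul_sym)
  finally show ?thesis
    by (simp add: meas_prob_def complex_eq_iff)
qed

definition coarse_grained ::
    "(nat \<Rightarrow> complex^'n^'n) \<Rightarrow> nat \<Rightarrow> nat \<Rightarrow> complex^'n^'n \<Rightarrow> complex^'n^'n" where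
  "coarse_grained P M d \<rho> = (\<Sum>i = 1..M. (meas_prob \<rho> (P i) / real d) *\<^sub>R P i)"

definition global_unitary ::
    "(nat \<Rightarrow> complex^'n^'n) \<Rightarrow> (nat \<Rightarrow> complex^'n) \<Rightarrow> nat \<Rightarrow> nat \<Rightarrow> complex^'n^'n \<Rightarrow> bool" where
  "global_unitary P \<phi> M d U \<longleftrightarrow>
     unitary U \<and>
     (\<forall>i\<in>{1..M}. \<exists>B. orthonormal_basis_of B (range (\<lambda>v. P i *v v)) \<and>
                      (\<lambda>v. U *v v) ` B = block \<phi> d i)"

text \<open>
  \<open>Tr[H(\<rho> - U \<rho>' U\<^sup>\<dagger>)]\<close> with \<open>\<rho>'\<close> the coarse-grained state. For \<open>U\<close> a \<^const>\<open>global_unitary\<close> of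
  \<open>P\<close> it is the observational ergotropy, for \<open>U\<close> a \<^const>\<open>global_unitary\<close> of \<open>P \<circ> \<pi>\<close> the guessed
  observational ergotropy; the coarse-grained state is that of \<open>P\<close> in both cases.
\<close>

definition obs_ergotropy ::
    "complex^'n^'n \<Rightarrow> (nat \<Rightarrow> complex^'n^'n) \<Rightarrow> nat \<Rightarrow> nat \<Rightarrow> complex^'n^'n \<Rightarrow> complex^'n^'n \<Rightarrow> complex"
  where
  "obs_ergotropy H P M d U \<rho> = trace (H ** (\<rho> - U ** coarse_grained P M d \<rho> ** adj U))"

end

theory Submission
  imports Defs
begin

text \<open>
  A projector with orthonormal basis \<open>B\<close> of its range is \<open>\<Sum>b\<in>B. |b\<rangle>\<langle>b|\<close>, so
  \<open>Tr[H U P U\<^sup>\<dagger>] = \<Sum>b\<in>B. \<langle>U b, H U b\<rangle>\<close>. If \<open>U\<close> maps \<open>B\<close> onto a block of eigenvectors, this is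
  \<open>d\<close> times the block energy. Hence \<open>Tr[H U \<rho>' U\<^sup>\<dagger>]\<close> is \<open>\<Sum>j. p j * block_energy E d j\<close> for the true
  ordering and \<open>\<Sum>j. p (\<pi> j) * block_energy E d j\<close> for the guessed one. The inequality holds
  because every eigenvalue is bounded by the spectral norm.
\<close>

lemma cinner_sum_scale:
  "cinner u (\<Sum>b\<in>B. c b *s f b) = (\<Sum>b\<in>B. c b * cinner u (f b))"
  unfolding cinner_def
  by (simp add: sum_component sum_distrib_left mult_ac) (rule sum.swap)

lemma cinner_scale_right: "cinner u (c *s v) = c * cinner u v"
  by (simp add: cinner_def sum_distrib_left mult_ac)

lemma cinner_adj: "cinner (A *v u) v = cinner u (adj A *v v)"
  unfolding cinner_def adj_def matrix_vector_mult_def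
  by (simp add: sum_distrib_left sum_distrib_right mult_ac) (rule sum.swap)

text \<open>Links the Hermitian product to the Euclidean norm that \<open>onorm\<close> uses, so
  that orthonormal vectors become unit vectors for the spectral norm.\<close>

lemma cinner_self: "cinner v v = complex_of_real ((norm v)\<^sup>2)"
proof -
  have "cinner v v = (\<Sum>i\<in>UNIV. complex_of_real ((norm (v $ i))\<^sup>2))"
    unfolding cinner_def by (intro sum.cong refl) (metis complex_norm_square mult.commute)
  also have "\<dots> = complex_of_real ((norm v)\<^sup>2)"
    by (simp add: norm_vec_def L2_set_def sum_nonneg)
  finally show ?thesis .
qed

text \<open>Write \<open>x\<close> as some combination of \<open>B\<close>; pairing it with
  \<open>b\<close> kills every term but one, so the coefficient of \<open>b\<close> must be
  \<open>cinner b x\<close>.\<close>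

lemma orthonormal_expansion:
  assumes "finite B" "orthonormal_set B" "x \<in> vec.span B"
  shows "x = (\<Sum>b\<in>B. cinner b x *s b)"
proof -
  obtain c where c: "x = (\<Sum>b\<in>B. c b *s b)"
    using assms(1,3) by (auto simp: vec.span_finite)
  have "cinner b x = c b" if "b \<in> B" for b
  proof -
    have "cinner b x = (\<Sum>a\<in>B. c a * (if b = a then 1 else 0))"
      using assms(2) that unfolding c cinner_sum_scale orthonormal_set_def
      by (intro sum.cong) auto
    also have "\<dots> = c b"
      using assms(1) that by (simp add: if_distrib cong: if_cong)
    finally show ?thesis .
  qed
  then show ?thesis
    using c by simp
qed

text \<open>Idempotence makes \<open>P\<close> fix each \<open>b\<close> in its range, and
  self-adjointness moves \<open>P\<close> from \<open>v\<close> onto \<open>b\<close> in the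
  coefficients of the expansion of \<open>P *v v\<close>.\<close>

lemma projector_expansion:
  assumes "projector P" "finite B" "orthonormal_basis_of B (range (\<lambda>v. P *v v))"
  shows "P *v v = (\<Sum>b\<in>B. cinner b v *s b)"
proof -
  have B: "orthonormal_set B" "vec.span B = range (\<lambda>v. P *v v)"
    using assms(3) by (auto simp: orthonormal_basis_of_def)
  have proj_id: "P *v b = b" if "b \<in> B" for b
  proof -
    have "b \<in> range (\<lambda>v. P *v v)"
      using B(2) that vec.span_base by blast
    then show ?thesis
      using assms(1) by (auto simp: projector_def matrix_vector_mul_assoc)
  qed
  have "P *v v = (\<Sum>b\<in>B. cinner b (P *v v) *s b)"
    using assms(2) B by (intro orthonormal_expansion) auto
  also have "\<dots> = (\<Sum>b\<in>B. cinner b v *s b)"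
  proof (intro sum.cong refl)
    fix b assume "b \<in> B"
    have "cinner b (P *v v) = cinner (P *v b) v"
      using assms(1) by (simp add: cinner_adj projector_def hermitian_def)
    then show "cinner b (P *v v) *s b = cinner b v *s b"
      using proj_id \<open>b \<in> B\<close> by simp
  qed
  finally show ?thesis .
qed

lemma trace_mult_projector:
  assumes "projector P" "finite B" "orthonormal_basis_of B (range (\<lambda>v. P *v v))"
  shows "trace (A ** P) = (\<Sum>b\<in>B. cinner b (A *v b))"
proof -
  have P: "P $ i $ j = (\<Sum>b\<in>B. cnj (b $ j) * b $ i)" for i j
  proof -
    \<comment> \<open>Applying \<open>P\<close> to a standard basis vector reads off column
      \<open>j\<close>, which turns the expansion of vectors into one of matrix entries.\<close>
    have "P $ i $ j = (P *v axis j 1) $ i"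
      by (simp add: matrix_vector_mult_def axis_def if_distrib cong: if_cong)
    also have "\<dots> = (\<Sum>b\<in>B. cinner b (axis j 1) * b $ i)"
      by (simp add: projector_expansion[OF assms] sum_component)
    also have "\<dots> = (\<Sum>b\<in>B. cnj (b $ j) * b $ i)"
      by (simp add: cinner_def axis_def if_distrib cong: if_cong)
    finally show ?thesis .
  qed
  have "trace (A ** P) = (\<Sum>i\<in>UNIV. \<Sum>k\<in>UNIV. \<Sum>b\<in>B. cnj (b $ i) * (A $ i $ k * b $ k))"
    by (simp add: trace_def matrix_matrix_mult_def P sum_distrib_left mult_ac)
  also have "\<dots> = (\<Sum>i\<in>UNIV. \<Sum>b\<in>B. \<Sum>k\<in>UNIV. cnj (b $ i) * (A $ i $ k * b $ k))"
    by (intro sum.cong refl sum.swap)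
  also have "\<dots> = (\<Sum>b\<in>B. \<Sum>i\<in>UNIV. \<Sum>k\<in>UNIV. cnj (b $ i) * (A $ i $ k * b $ k))"
    by (rule sum.swap)
  also have "\<dots> = (\<Sum>b\<in>B. cinner b (A *v b))"
    by (simp add: cinner_def matrix_vector_mult_def sum_distrib_left)
  finally show ?thesis .
qed

lemma trace_mult_sum_scaleR:
  fixes A :: "complex^'n^'n"
  assumes "finite I"
  shows "trace (A ** (\<Sum>i\<in>I. c i *\<^sub>R Q i)) = (\<Sum>i\<in>I. complex_of_real (c i) * trace (A ** Q i))"
  using assms
proof (induction I rule: finite_induct)
  case empty
  then show ?case by (simp add: trace_def matrix_matrix_mult_def)
next
  case (insert i I)
  have "trace (A ** (c i *\<^sub>R Q i)) = complex_of_real (c i) * trace (A ** Q i)"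
    unfolding trace_def matrix_matrix_mult_def
    by (simp add: sum_distrib_left mult_ac scaleR_conv_of_real[where 'a=complex])
  then show ?case
    using insert by (simp add: matrix_add_ldistrib trace_add)
qed

lemma inj_unitary: "unitary U \<Longrightarrow> inj (\<lambda>v. U *v v)"
  by (rule inj_on_inverseI[where g = "\<lambda>v. adj U *v v"])
    (simp add: unitary_def matrix_vector_mul_assoc)

lemma eigenbasis_cinner:
  assumes "orthonormal_eigenbasis H E \<phi> N" "k \<in> {1..N}"
  shows "cinner (\<phi> k) (\<phi> k) = 1"
  using assms
  by (auto simp: orthonormal_eigenbasis_def orthonormal_basis_of_def orthonormal_set_def)

text \<open>With the rotation moved onto \<open>H\<close>, the trace is a sum over \<open>B\<close>.
  Each \<open>U *v b\<close> is an eigenvector from block \<open>j\<close>, so the sum collects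
  exactly the eigenvalues of that block.\<close>

lemma trace_rotated_projector:
  assumes eig: "orthonormal_eigenbasis H E \<phi> N" and "j * d \<le> N" and "0 < d" and "projector Q"
    and U: "unitary U"
    and B: "orthonormal_basis_of B (range (\<lambda>v. Q *v v))" "(\<lambda>v. U *v v) ` B = block \<phi> d j"
  shows "trace (adj U ** H ** U ** Q) = complex_of_real (real d * block_energy E d j)"
proof -
  let ?K = "{(j - 1) * d + 1..j * d}"
  have K: "?K \<subseteq> {1..N}"
    using assms(2) by auto
  have inj: "inj_on (\<lambda>v. U *v v) B"
    using inj_unitary[OF U] by (rule inj_on_subset) simp
  \<comment> \<open>Finiteness is not part of \<open>orthonormal_basis_of\<close>; it is pulled back
    from the finite block along the injective map given by \<open>U\<close>.\<close>
  have "finite ((\<lambda>v. U *v v) ` B)"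
    by (simp add: B(2) block_def)
  then have fin: "finite B"
    using inj by (rule finite_imageD)
  have "trace (adj U ** H ** U ** Q) = (\<Sum>b\<in>B. cinner b ((adj U ** H ** U) *v b))"
    by (rule trace_mult_projector[OF assms(4) fin B(1)])
  also have "\<dots> = (\<Sum>b\<in>B. cinner (U *v b) (H *v (U *v b)))"
    by (simp add: cinner_adj matrix_vector_mul_assoc matrix_mul_assoc)
  also have "\<dots> = (\<Sum>v\<in>block \<phi> d j. cinner v (H *v v))"
    using sum.reindex[OF inj, of "\<lambda>v. cinner v (H *v v)"] by (simp add: B(2))
  also have "\<dots> = (\<Sum>k\<in>?K. cinner (\<phi> k) (H *v \<phi> k))"
  proof -
    have "inj_on \<phi> ?K"
      using eig K by (auto simp: orthonormal_eigenbasis_def intro: inj_on_subset)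
    then show ?thesis
      by (simp add: block_def sum.reindex)
  qed
  also have "\<dots> = (\<Sum>k\<in>?K. complex_of_real (E k))"
  proof (intro sum.cong refl)
    fix k assume "k \<in> ?K"
    then have k: "k \<in> {1..N}"
      using K by blast
    then have "H *v \<phi> k = complex_of_real (E k) *s \<phi> k"
      using eig by (simp add: orthonormal_eigenbasis_def)
    then show "cinner (\<phi> k) (H *v \<phi> k) = complex_of_real (E k)"
      by (simp add: cinner_scale_right eigenbasis_cinner[OF eig k])
  qed
  also have "\<dots> = complex_of_real (real d * block_energy E d j)"
    using assms(3) by (simp add: block_energy_def)
  finally show ?thesis .
qed

text \<open>The eigenvector \<open>\<phi> k\<close> is a unit vector that \<open>H\<close> stretches
  by the factor \<open>\<bar>E k\<bar>\<close>.\<close>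

lemma abs_eigenvalue_le_spectral_norm:
  assumes "orthonormal_eigenbasis H E \<phi> N" "k \<in> {1..N}"
  shows "\<bar>E k\<bar> \<le> spectral_norm H"
proof -
  have "complex_of_real ((norm (\<phi> k))\<^sup>2) = 1"
    using eigenbasis_cinner[OF assms] by (simp only: cinner_self)
  then have 1: "norm (\<phi> k) = 1"
    by (metis norm_ge_zero of_real_eq_1_iff power2_eq_1_iff zero_le_one neg_0_le_iff_le not_one_le_zero)
  \<comment> \<open>The eigenvalue is real, so complex scaling can be replaced by real scaling,
    whose effect on the norm is immediate.\<close>
  have "H *v \<phi> k = E k *\<^sub>R \<phi> k"
    using assms by (simp add: orthonormal_eigenbasis_def vec_eq_iff scaleR_conv_of_real[where 'a=complex])
  then have "norm (H *v \<phi> k) = \<bar>E k\<bar>"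
    by (simp add: 1)
  moreover have "bounded_linear (\<lambda>v. H *v v)"
    by (rule matrix_vector_mul_bounded_linear)
  then have "norm (H *v \<phi> k) \<le> spectral_norm H * norm (\<phi> k)"
    unfolding spectral_norm_def by (rule onorm)
  ultimately show ?thesis
    by (simp add: 1)
qed

lemma abs_block_energy_le:
  assumes "\<And>k. k \<in> {1..j * d} \<Longrightarrow> \<bar>E k\<bar> \<le> c" "0 < d" "0 < j"
  shows "\<bar>block_energy E d j\<bar> \<le> c"
proof -
  let ?K = "{(j - 1) * d + 1..j * d}"
  have "\<bar>\<Sum>k\<in>?K. E k\<bar> \<le> (\<Sum>k\<in>?K. c)"
    using assms(1) by (intro order_trans[OF sum_abs] sum_mono) auto
  \<comment> \<open>For \<open>0 < j\<close> the block has exactly \<open>d\<close> indices; at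
    \<open>j = 0\<close> truncated subtraction would leave the empty set.\<close>
  also have "\<dots> = real d * c"
    using assms(3) by (simp add: diff_mult_distrib)
  finally show ?thesis
    using assms(2) by (simp add: block_energy_def field_simps)
qed

text \<open>Covers both ergotropies at once: the identity for \<sigma> gives the true ordering,
  \<pi> the guessed one. The state itself is built from \<open>P\<close> in either case.\<close>

lemma trace_rotated_coarse_grained:
  assumes "orthonormal_eigenbasis H E \<phi> N" "M * d \<le> N" "0 < d"
    and "\<forall>i\<in>{1..M}. projector (P i)" and \<sigma>: "\<sigma> permutes {1..M}"
    and U: "global_unitary (P \<circ> \<sigma>) \<phi> M d U"
  shows "trace (H ** (U ** coarse_grained P M d \<rho> ** adj U)) =
    complex_of_real (\<Sum>j = 1..M. meas_prob \<rho> (P (\<sigma> j)) * block_energy E d j)"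
proof -
  let ?t = "\<lambda>i. complex_of_real (meas_prob \<rho> (P i) / real d) * trace (adj U ** H ** U ** P i)"
  \<comment> \<open>Cyclicity of the trace transfers the conjugation to \<open>H\<close>, leaving
    the coarse-grained state as the last factor, where linearity applies.\<close>
  have "trace (H ** (U ** coarse_grained P M d \<rho> ** adj U)) =
      trace (adj U ** H ** U ** coarse_grained P M d \<rho>)"
    using trace_mul_sym[of "H ** U ** coarse_grained P M d \<rho>" "adj U"]
    by (simp add: matrix_mul_assoc)
  also have "\<dots> = (\<Sum>i = 1..M. ?t i)"
    unfolding coarse_grained_def by (rule trace_mult_sum_scaleR) simp
  \<comment> \<open>Reindexing by \<sigma> pairs block \<open>j\<close> with the projector
    \<open>P (\<sigma> j)\<close> whose range \<open>U\<close> carries onto its span.\<close>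
  also have "\<dots> = (\<Sum>j = 1..M. ?t (\<sigma> j))"
    using sum.permute[OF \<sigma>, of ?t] by (simp add: o_def)
  also have "\<dots> = (\<Sum>j = 1..M. complex_of_real (meas_prob \<rho> (P (\<sigma> j)) * block_energy E d j))"
  proof (intro sum.cong refl)
    fix j assume j: "j \<in> {1..M}"
    then have "j * d \<le> N"
      using assms(2) by (meson atLeastAtMost_iff le_trans mult_le_mono1)
    moreover have "projector (P (\<sigma> j))"
      using assms(4) j permutes_in_image[OF \<sigma>] by blast
    moreover obtain B where "orthonormal_basis_of B (range (\<lambda>v. P (\<sigma> j) *v v))"
      "(\<lambda>v. U *v v) ` B = block \<phi> d j"
      using U j unfolding global_unitary_def comp_def by blast
    moreover have "unitary U"
      using U by (simp add: global_unitary_def)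
    ultimately have "trace (adj U ** H ** U ** P (\<sigma> j)) =
        complex_of_real (real d * block_energy E d j)"
      using assms(1,3) by (intro trace_rotated_projector)
    then show "?t (\<sigma> j) = complex_of_real (meas_prob \<rho> (P (\<sigma> j)) * block_energy E d j)"
      using assms(3) by simp
  qed
  finally show ?thesis by simp
qed

theorem lemma2:
  fixes n r N d M :: nat
    and H \<rho> U_gl U_gl' :: "complex^'n^'n"
    and P :: "nat \<Rightarrow> complex^'n^'n"
    and E p p_est :: "nat \<Rightarrow> real"
    and \<phi> :: "nat \<Rightarrow> complex^'n"
    and \<pi> :: "nat \<Rightarrow> nat"
  assumes "N = 2 ^ n" and "d = 2 ^ r" and "r \<le> n" and "M = N div d" and "CARD('n) = N"
    and "hermitian H"
    and "\<forall>k\<in>{1..<N}. E k \<le> E (k + 1)"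
    and "orthonormal_eigenbasis H E \<phi> N"
    and "\<forall>i\<in>{1..M}. projector (P i) \<and> rank (P i) = d"
    and "\<forall>i\<in>{1..M}. \<forall>j\<in>{1..M}. i \<noteq> j \<longrightarrow> P i ** P j = 0"
    and "(\<Sum>i = 1..M. P i) = mat 1"
    and "density_operator \<rho>"
    and "\<forall>i\<in>{1..M}. p i = meas_prob \<rho> (P i)"
    and "\<forall>i\<in>{1..<M}. p i \<ge> p (i + 1)"
    and "\<pi> permutes {1..M}"
    and "\<forall>i\<in>{1..<M}. p_est (\<pi> i) \<ge> p_est (\<pi> (i + 1))"
    and "global_unitary P \<phi> M d U_gl"
    and "global_unitary (P \<circ> \<pi>) \<phi> M d U_gl'"
  shows "cmod (obs_ergotropy H P M d U_gl' \<rho> - obs_ergotropy H P M d U_gl \<rho>) =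
           \<bar>\<Sum>j = 1..M. (p j - p (\<pi> j)) * block_energy E d j\<bar> \<and>
         \<bar>\<Sum>j = 1..M. (p j - p (\<pi> j)) * block_energy E d j\<bar> \<le>
           spectral_norm H * (\<Sum>j = 1..M. \<bar>p j - p (\<pi> j)\<bar>)"
proof
  have d: "0 < d" and Md: "M * d \<le> N"
    using assms(2,4) by auto
  have proj: "\<forall>i\<in>{1..M}. projector (P i)"
    using assms(9) by blast
  have p: "meas_prob \<rho> (P (\<pi> j)) = p (\<pi> j)" "meas_prob \<rho> (P j) = p j" if "j \<in> {1..M}" for j
    using that assms(13) permutes_in_image[OF assms(15)] by (metis, metis)
  have "trace (H ** (U_gl' ** coarse_grained P M d \<rho> ** adj U_gl')) =
      complex_of_real (\<Sum>j = 1..M. p (\<pi> j) * block_energy E d j)"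
    using trace_rotated_coarse_grained[OF assms(8) Md d proj assms(15,18)] by (simp add: p)
  \<comment> \<open>The instance with the identity permutation, since \<open>P \<circ> id\<close> is
    \<open>P\<close>.\<close>
  moreover have "trace (H ** (U_gl ** coarse_grained P M d \<rho> ** adj U_gl)) =
      complex_of_real (\<Sum>j = 1..M. p j * block_energy E d j)"
    using trace_rotated_coarse_grained[OF assms(8) Md d proj permutes_id, of U_gl] assms(17)
    by (simp add: p)
  moreover have "H ** (A - B) = H ** A - H ** B" for A B :: "complex^'n^'n"
    using matrix_add_ldistrib[of H "A - B" B] by (simp add: algebra_simps)
  \<comment> \<open>The term \<open>trace (H ** \<rho>)\<close> is common to both ergotropies and
    cancels. The rotated energies enter with a minus sign, hence \<open>p j - p (\<pi> j)\<close> in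
    this order.\<close>
  ultimately have "obs_ergotropy H P M d U_gl' \<rho> - obs_ergotropy H P M d U_gl \<rho> =
      complex_of_real (\<Sum>j = 1..M. (p j - p (\<pi> j)) * block_energy E d j)"
    by (simp add: obs_ergotropy_def trace_sub left_diff_distrib sum_subtractf)
  then show "cmod (obs_ergotropy H P M d U_gl' \<rho> - obs_ergotropy H P M d U_gl \<rho>) =
      \<bar>\<Sum>j = 1..M. (p j - p (\<pi> j)) * block_energy E d j\<bar>"
    by (simp only: norm_of_real)
  \<comment> \<open>A block energy is an average of eigenvalues and inherits their common bound; the
    triangle inequality then gives the estimate.\<close>
  have "\<bar>block_energy E d j\<bar> \<le> spectral_norm H" if "j \<in> {1..M}" for j
  proof (rule abs_block_energy_le)
    fix k assume k: "k \<in> {1..j * d}"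
    have "j * d \<le> M * d"
      using that by (intro mult_le_mono1) simp
    then have "k \<in> {1..N}"
      using k Md unfolding atLeastAtMost_iff by linarith
    then show "\<bar>E k\<bar> \<le> spectral_norm H"
      by (rule abs_eigenvalue_le_spectral_norm[OF assms(8)])
  qed (use d that in auto)
  then have "(\<Sum>j = 1..M. \<bar>(p j - p (\<pi> j)) * block_energy E d j\<bar>) \<le>
      (\<Sum>j = 1..M. spectral_norm H * \<bar>p j - p (\<pi> j)\<bar>)"
    by (intro sum_mono) (simp add: abs_mult mult.commute mult_right_mono)
  then show "\<bar>\<Sum>j = 1..M. (p j - p (\<pi> j)) * block_energy E d j\<bar> \<le>
      spectral_norm H * (\<Sum>j = 1..M. \<bar>p j - p (\<pi> j)\<bar>)"
    using sum_abs[of "\<lambda>j. (p j - p (\<pi> j)) * block_energy E d j" "{1..M}"]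
    by (simp only: sum_distrib_left)
qed

end
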